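(* For every $n\ge 1$, the coefficient of $t$ in the order polynomial $\Omega_{\mathcal{C}_{2n}}(t)$ of the crown poset is $$[t]\,\Omega_{\mathcal{C}_{2n}}(t) = \binom{2n}{n}^{-1}.$$
   Context: The crown poset $\mathcal{C}_{2n}$ is the poset on $[2n]$ with cover relations $1\prec 2\succ 3\prec\cdots\succ 2n-1\prec 2n\succ 1$ (for $n=1$ it is the chain $1\prec 2$). For a finite poset $P$, the order polynomial $\Omega_P(t)$ is the unique polynomial such that for every positive integer $m$, $\Omega_P(m)$ is the number of order-preserving maps $P\to[m]$. $[t^k]p(t)$ denotes the coefficient of $t^k$ in $p(t)$. *)

theory Defs
  imports "HOL-Computational_Algebra.Polynomial" "HOL-Library.FuncSet"
begin

text \<open>
  A poset is given by its carrier \<open>A\<close> and its reflexive order relation \<open>r\<close>. Maps \<open>A \<rightarrow> [m]\<close> are taken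
  to be extensional (\<open>undefined\<close> outside \<open>A\<close>), so that their number is the intended one.
\<close>

definition order_preserving_maps :: "'a set \<Rightarrow> 'a rel \<Rightarrow> nat \<Rightarrow> ('a \<Rightarrow> nat) set" where
  "order_preserving_maps A r m =
     {f \<in> A \<rightarrow>\<^sub>E {1..m}. monotone_on A (\<lambda>x y. (x, y) \<in> r) (\<le>) f}"

definition order_polynomial :: "'a set \<Rightarrow> 'a rel \<Rightarrow> rat poly" where
  "order_polynomial A r =
     (THE p. \<forall>m>0. poly p (of_nat m) = of_nat (card (order_preserving_maps A r m)))"

text \<open>
  The pairs are written (smaller, larger). For \<open>n = 1\<close> the only pair is \<open>(1, 2)\<close>; \<open>n = 0\<close> is
  meaningless.
\<close>

definition crown_covers :: "nat \<Rightarrow> nat rel" where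
  "crown_covers n =
     {(2 * i - 1, 2 * i) |i. 1 \<le> i \<and> i \<le> n} \<union>
     {(2 * i + 1, 2 * i) |i. 1 \<le> i \<and> i < n} \<union>
     {(1, 2 * n)}"

definition crown_order :: "nat \<Rightarrow> nat rel" where
  "crown_order n = Id_on {1..2 * n} \<union> (crown_covers n)\<^sup>+"

lemma crown_covers_odd_even: "(a, b) \<in> crown_covers n \<Longrightarrow> odd a \<and> even b"
  by (auto simp: crown_covers_def)

lemma crown_covers_subset: "n \<ge> 1 \<Longrightarrow> crown_covers n \<subseteq> {1..2 * n} \<times> {1..2 * n}"
  by (auto simp: crown_covers_def)

lemma trancl_crown_covers: "(crown_covers n)\<^sup>+ = crown_covers n"
  by (rule trancl_id, rule transI) (metis crown_covers_odd_even)

lemma partial_order_on_crown_order: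
  assumes "n \<ge> 1"
  shows "partial_order_on {1..2 * n} (crown_order n)"
proof -
  have "antisym (crown_order n)"
    unfolding crown_order_def trancl_crown_covers
    by (rule antisymI) (auto dest: crown_covers_odd_even)
  moreover have "trans (crown_order n)"
    unfolding crown_order_def trancl_crown_covers
    by (rule transI) (auto dest: crown_covers_odd_even)
  moreover have "crown_order n \<subseteq> {1..2 * n} \<times> {1..2 * n}"
    using crown_covers_subset[OF assms] unfolding crown_order_def trancl_crown_covers by auto
  moreover have "refl_on {1..2 * n} (crown_order n)"
    by (auto simp: refl_on_def crown_order_def)
  ultimately show ?thesis
    by (simp add: partial_order_on_def preorder_on_def)
qed

text \<open>Well-definedness of the order polynomial: count the maps by their image in \<open>[m]\<close>.\<close>

lemma card_surjective_order_preserving_maps: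
  fixes S :: "nat set"
  assumes "finite S"
  shows "card {f \<in> A \<rightarrow>\<^sub>E S. f ` A = S \<and> monotone_on A (\<lambda>x y. (x, y) \<in> r) (\<le>) f} =
         card {f \<in> A \<rightarrow>\<^sub>E {0..<card S}. f ` A = {0..<card S} \<and>
                 monotone_on A (\<lambda>x y. (x, y) \<in> r) (\<le>) f}"
    (is "card ?F = card ?G")
proof -
  obtain h where h: "bij_betw h {0..<card S} S" "strict_mono_on {0..<card S} h"
    using ex_bij_betw_strict_mono_card[OF assms] unfolding lessThan_atLeast0 by metis
  define k where "k = inv_into {0..<card S} h"
  have hS: "h ` {0..<card S} = S" using h(1) by (simp add: bij_betw_def)
  have kh: "k (h i) = i" if "i < card S" for i
    using h(1) that by (auto simp: k_def bij_betw_def inv_into_f_f)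
  have hk: "h (k s) = s" "k s < card S" if "s \<in> S" for s
    using that inv_into_into[of s h "{0..<card S}"] hS by (auto simp: k_def f_inv_into_f)
  have hle: "h i \<le> h j \<longleftrightarrow> i \<le> j" if "i < card S" "j < card S" for i j
    using strict_mono_on_leD[OF h(2), of i j] strict_mono_onD[OF h(2), of j i] that
    by (auto simp: not_le[symmetric])
  have kle: "k s \<le> k t \<longleftrightarrow> s \<le> t" if "s \<in> S" "t \<in> S" for s t
    using hle[of "k s" "k t"] hk that by simp
  have kS: "k ` S = {0..<card S}"
    using kh hk hS by (auto simp: image_iff) (metis atLeastLessThan_iff image_eqI le0)
  have "bij_betw (\<lambda>f. restrict (h \<circ> f) A) ?G ?F"
  proof (rule bij_betw_byWitness[where f' = "\<lambda>f. restrict (k \<circ> f) A"])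
    show "\<forall>f\<in>?G. restrict (k \<circ> restrict (h \<circ> f) A) A = f"
      by (auto simp: fun_eq_iff restrict_def PiE_def Pi_def extensional_def kh)
    show "\<forall>f\<in>?F. restrict (h \<circ> restrict (k \<circ> f) A) A = f"
      by (auto simp: fun_eq_iff restrict_def PiE_def Pi_def extensional_def hk)
    show "(\<lambda>f. restrict (h \<circ> f) A) ` ?G \<subseteq> ?F"
    proof (rule image_subsetI, elim CollectE conjE, intro CollectI conjI)
      fix f assume f: "f \<in> A \<rightarrow>\<^sub>E {0..<card S}" "f ` A = {0..<card S}"
        "monotone_on A (\<lambda>x y. (x, y) \<in> r) (\<le>) f"
      show "restrict (h \<circ> f) A \<in> A \<rightarrow>\<^sub>E S" using f(1) hS by (auto simp: PiE_def Pi_def)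
      show "restrict (h \<circ> f) A ` A = S"
        using f(2) hS by (simp only: image_restrict_eq image_comp[symmetric])
      show "monotone_on A (\<lambda>x y. (x, y) \<in> r) (\<le>) (restrict (h \<circ> f) A)"
        using f(1,3) by (auto simp: monotone_on_def PiE_def Pi_def hle)
    qed
    show "(\<lambda>f. restrict (k \<circ> f) A) ` ?F \<subseteq> ?G"
    proof (rule image_subsetI, elim CollectE conjE, intro CollectI conjI)
      fix f assume f: "f \<in> A \<rightarrow>\<^sub>E S" "f ` A = S"
        "monotone_on A (\<lambda>x y. (x, y) \<in> r) (\<le>) f"
      show "restrict (k \<circ> f) A \<in> A \<rightarrow>\<^sub>E {0..<card S}"
        using f(1) hk by (auto simp: PiE_def Pi_def)
      show "restrict (k \<circ> f) A ` A = {0..<card S}"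
        using f(2) kS by (simp only: image_restrict_eq image_comp[symmetric])
      show "monotone_on A (\<lambda>x y. (x, y) \<in> r) (\<le>) (restrict (k \<circ> f) A)"
        using f(1,3) by (auto simp: monotone_on_def PiE_def Pi_def kle)
    qed
  qed
  from bij_betw_same_card[OF this] show ?thesis by (rule sym)
qed

lemma card_order_preserving_maps:
  fixes A :: "'a set" and r :: "'a rel"
  assumes "finite A"
  defines "s \<equiv> \<lambda>k. card {f \<in> A \<rightarrow>\<^sub>E {0..<k}. f ` A = {0..<k} \<and>
                     monotone_on A (\<lambda>x y. (x, y) \<in> r) (\<le>) f}"
  shows "card (order_preserving_maps A r m) = (\<Sum>k\<le>card A. (m choose k) * s k)"
proof -
  define F where "F S = {f \<in> A \<rightarrow>\<^sub>E S. f ` A = S \<and> monotone_on A (\<lambda>x y. (x, y) \<in> r) (\<le>) f}"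
    for S :: "nat set"
  have eq: "order_preserving_maps A r m = (\<Union>S\<in>Pow {1..m}. F S)"
    by (auto simp: order_preserving_maps_def F_def PiE_def Pi_def)
  have fin: "finite (F S)" if "finite S" for S
    by (rule finite_subset[of _ "A \<rightarrow>\<^sub>E S"]) (use assms that in \<open>auto simp: F_def intro!: finite_PiE\<close>)
  have cF: "card (F S) = s (card S)" if "finite S" for S
    using card_surjective_order_preserving_maps[OF that, of A r] by (simp add: F_def s_def)
  have s0: "s k = 0" if "k > card A" for k
  proof -
    have "\<not> f ` A = {0..<k}" for f :: "'a \<Rightarrow> nat"
      using card_image_le[OF assms(1), of f] that by auto
    thus ?thesis by (simp add: s_def)
  qed
  have "card (order_preserving_maps A r m) = (\<Sum>S\<in>Pow {1..m}. card (F S))"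
    unfolding eq
  proof (rule card_UN_disjoint)
    show "\<forall>S\<in>Pow {1..m}. finite (F S)"
      by (auto intro!: fin finite_subset[of _ "{1..m}"])
  qed (auto simp: F_def)
  also have "\<dots> = (\<Sum>S\<in>Pow {1..m}. s (card S))"
    by (rule sum.cong) (auto intro!: cF finite_subset[of _ "{1..m}"])
  also have "\<dots> = (\<Sum>k\<le>m. \<Sum>S\<in>{S\<in>Pow {1..m}. card S = k}. s (card S))"
    by (rule sum.group[symmetric]) (auto dest: card_mono[rotated])
  also have "\<dots> = (\<Sum>k\<le>m. (m choose k) * s k)"
    using n_subsets[of "{1..m}"] by (intro sum.cong) auto
  also have "\<dots> = (\<Sum>k\<le>max m (card A). (m choose k) * s k)"
    by (rule sum.mono_neutral_left) auto
  also have "\<dots> = (\<Sum>k\<le>card A. (m choose k) * s k)"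
    by (rule sum.mono_neutral_right) (auto simp: s0)
  finally show ?thesis .
qed

lemma ex1_order_polynomial:
  assumes "finite A"
  shows "\<exists>!p :: rat poly. \<forall>m>0. poly p (of_nat m) = of_nat (card (order_preserving_maps A r m))"
proof (rule ex_ex1I)
  define s where "s k = card {f \<in> A \<rightarrow>\<^sub>E {0..<k}. f ` A = {0..<k} \<and>
                     monotone_on A (\<lambda>x y. (x, y) \<in> r) (\<le>) f}" for k :: nat
  define b where "b k = smult (1 / fact k) (\<Prod>i<k. [:- of_nat i, 1:] :: rat poly)" for k :: nat
  have b: "poly (b k) (of_nat m) = of_nat (m choose k)" for k m :: nat
  proof -
    have "of_nat (m choose k) = (\<Prod>i = 0..<k. of_nat m - of_nat i :: rat) / fact k"
      by (simp only: binomial_gbinomial gbinomial_prod_rev)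
    thus ?thesis
      by (simp only: b_def poly_smult poly_prod lessThan_atLeast0 poly_pCons poly_0) simp
  qed
  have "poly (\<Sum>k\<le>card A. smult (of_nat (s k)) (b k)) (of_nat m)
          = of_nat (card (order_preserving_maps A r m))" for m
    unfolding card_order_preserving_maps[OF assms] s_def[symmetric]
    by (simp add: poly_sum b mult.commute)
  thus "\<exists>p :: rat poly. \<forall>m>0. poly p (of_nat m) = of_nat (card (order_preserving_maps A r m))"
    by blast
next
  fix p q :: "rat poly"
  assume p: "\<forall>m>0. poly p (of_nat m) = of_nat (card (order_preserving_maps A r m))"
    and q: "\<forall>m>0. poly q (of_nat m) = of_nat (card (order_preserving_maps A r m))"
  have "of_nat ` {0<..} \<subseteq> {x. poly (p - q) x = 0}"
    using p q by auto
  moreover have "infinite (of_nat ` {0<..} :: rat set)"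
    by (subst finite_image_iff) (auto simp: inj_on_def infinite_Ioi)
  ultimately have "infinite {x. poly (p - q) x = 0}"
    using finite_subset by blast
  thus "p = q"
    using poly_roots_finite[of "p - q"] by auto
qed

lemma poly_order_polynomial:
  assumes "finite A" "m > 0"
  shows "poly (order_polynomial A r) (of_nat m) = of_nat (card (order_preserving_maps A r m))"
  unfolding order_polynomial_def
  by (rule theI'[OF ex1_order_polynomial[OF assms(1)], rule_format, OF assms(2)])

end

theory Submission
  imports Defs "HOL-Computational_Algebra.Formal_Power_Series"
begin

text \<open>
  Write \<open>K\<close> for the \<open>m \<times> m\<close> matrix with entries \<open>min i j\<close>, \<open>1 \<le> i, j \<le> m\<close>. Once the values of an
  order-preserving map at the \<open>n\<close> maximal elements of the crown are fixed, the value at the minimal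
  element between two neighbours with values \<open>i\<close> and \<open>j\<close> can be chosen in \<open>min i j\<close> ways. Hence the
  number \<open>\<Omega>\<^sub>n(m)\<close> of order-preserving maps into \<open>[m]\<close> is the trace of \<open>K\<^sup>n\<close>.

  The determinant \<open>D\<^sub>m(x) = det (1 - x K)\<close> equals \<open>\<Sum>\<^sub>k (-1)\<^sup>k (m + k choose 2 k) x\<^sup>k\<close>, a difference
  of Chebyshev polynomials, because the inverse of \<open>K\<close> is the tridiagonal matrix of a discrete
  second derivative. So the power sums \<open>\<Omega>\<^sub>n(m)\<close> of the eigenvalues of \<open>K\<close> satisfy Newton's identities
  \<open>(\<Sum>k<n. c\<^sub>k(m) * \<Omega>\<^bsub>n-k\<^esub>(m)) = - n * c\<^sub>n(m)\<close>, where \<open>c\<^sub>k(t) = (-1)\<^sup>k (t + k choose 2 k)\<close>.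
  Here \<open>c\<^sub>k\<close> is a polynomial in \<open>t\<close>, and so the identities hold for the order polynomials themselves.
  For \<open>k \<ge> 1\<close> the polynomial \<open>c\<^sub>k\<close> vanishes at \<open>0\<close>, and then so does every \<open>\<Omega>\<^sub>n\<close> with \<open>n \<ge> 1\<close>. A
  product of two polynomials that vanish at \<open>0\<close> has no linear term; therefore only \<open>k = 0\<close> contributes
  to the linear coefficient of the left-hand side, and \<open>[t] \<Omega>\<^sub>n = - n [t] c\<^sub>n\<close>. The factorisation of
  \<open>c\<^sub>n\<close> into linear factors gives \<open>n! n! / (2 n)!\<close> for this number.

  Newton's identities are obtained in \<open>newton_identity\<close> without eigenvalues or determinants:
  \<open>min_det_resolvent\<close> gives the entries of \<open>D\<^sub>m(x) K (1 - x K)\<^sup>-\<^sup>1\<close> explicitly, as a Green's function,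
  and \<open>min_det_deriv\<close> recognises their trace as the negative derivative of \<open>D\<^sub>m\<close>.
\<close>

section \<open>The characteristic series of the matrix of minima\<close>

text \<open>
  In terms of the Chebyshev polynomials of the second kind, \<open>cheb n\<close> is \<open>U\<^bsub>n-1\<^esub>(1 - x / 2)\<close>. It solves
  the eigenvalue equation \<open>2 f(j) - f(j - 1) - f(j + 1) = x f(j)\<close> with \<open>f(0) = 0\<close>.
\<close>

fun cheb :: "nat \<Rightarrow> rat fps" where
  "cheb 0 = 0"
| "cheb (Suc 0) = 1"
| "cheb (Suc (Suc n)) = (2 - fps_X) * cheb (Suc n) - cheb n"

text \<open>
  The determinant of \<open>1 - x K\<close>. As a function of \<open>m\<close> it solves the same recurrence as \<open>cheb\<close>, but with
  the boundary condition that its values at \<open>-1\<close> and \<open>0\<close> agree. Truncated subtraction on \<open>nat\<close> builds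
  this condition in, so that the recurrence below also covers \<open>a = 0\<close>.
\<close>

definition min_det :: "nat \<Rightarrow> rat fps" where
  "min_det m = cheb (Suc m) - cheb m"

lemma min_det_0 [simp]: "min_det 0 = 1"
  by (simp add: min_det_def)

lemma min_det_Suc: "min_det (Suc a) = (2 - fps_X) * min_det a - min_det (a - 1)"
  by (cases a) (simp_all add: min_det_def algebra_simps)

lemma cheb_nth: "fps_nth (cheb n) k = (- 1) ^ k * of_nat ((n + k) choose (2 * k + 1))"
proof (induction n arbitrary: k rule: cheb.induct)
  case 1
  then show ?case by (simp add: binomial_eq_0)
next
  case 2
  then show ?case by (cases k) (auto simp: binomial_eq_0)
next
  case (3 n)
  have X: "fps_nth (cheb (Suc (Suc n))) k
     = 2 * fps_nth (cheb (Suc n)) k - (if k = 0 then 0 else fps_nth (cheb (Suc n)) (k - 1))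
        - fps_nth (cheb n) k"
    by (simp add: left_diff_distrib numeral_fps_const)
  show ?case
  proof (cases k)
    case 0
    show ?thesis unfolding X 3 unfolding 0 by simp
  next
    case (Suc l)
    show ?thesis unfolding X 3 unfolding Suc by (simp add: algebra_simps)
  qed
qed

lemma min_det_nth: "fps_nth (min_det m) k = (- 1) ^ k * of_nat ((m + k) choose (2 * k))"
  by (simp add: min_det_def cheb_nth algebra_simps)

text \<open>
  Both sides obey the recurrence of \<open>cheb\<close> with the same inhomogeneity \<open>min_det (Suc m)\<close>: on the right it
  comes from differentiating the factor \<open>2 - x\<close>, on the left from the ends of the convolution.
\<close>

lemma min_det_deriv: "(\<Sum>i\<le>m. cheb i * min_det (m - i)) = - fps_deriv (min_det m)"
proof (induction m rule: induct_nat_012)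
  case 0
  show ?case by simp
next
  case 1
  show ?case by (simp add: min_det_def numeral_fps_const)
next
  case (ge2 m)
  let ?S = "\<lambda>m. \<Sum>i\<le>m. cheb i * min_det (m - i)"
  have "?S (Suc (Suc m)) = (\<Sum>i\<le>m. cheb i * min_det (Suc (Suc (m - i))))
      + cheb (Suc m) * min_det 1 + cheb (Suc (Suc m))"
    by (simp add: Suc_diff_le)
  also have "(\<Sum>i\<le>m. cheb i * min_det (Suc (Suc (m - i))))
      = (2 - fps_X) * (\<Sum>i\<le>m. cheb i * min_det (Suc (m - i))) - ?S m"
    by (subst min_det_Suc) (simp add: sum_distrib_left algebra_simps flip: sum.distrib sum_subtractf)
  also have "(\<Sum>i\<le>m. cheb i * min_det (Suc (m - i))) = ?S (Suc m) - cheb (Suc m)"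
    by (simp add: Suc_diff_le)
  also have "(2 - fps_X) * (?S (Suc m) - cheb (Suc m)) - ?S m + cheb (Suc m) * min_det 1 + cheb (Suc (Suc m))
     = (2 - fps_X) * ?S (Suc m) - ?S m + min_det (Suc m)"
    by (simp add: min_det_def algebra_simps)
  also have "\<dots> = - fps_deriv (min_det (Suc (Suc m)))"
    unfolding ge2 min_det_Suc[of "Suc m"] by (simp add: algebra_simps numeral_fps_const)
  finally show ?case .
qed

text \<open>
  The Wronskian of the two solutions \<open>cheb i\<close> and \<open>min_det (m - i)\<close> of one recurrence does not depend
  on \<open>i\<close>; at \<open>i = 0\<close> it is \<open>min_det m\<close>.
\<close>

lemma min_det_wronskian:
  assumes "i \<le> m"
  shows "cheb (Suc i) * min_det (m - i) - cheb i * min_det (m - i - 1) = min_det m"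
  using assms
proof (induction i)
  case 0
  show ?case by simp
next
  case (Suc i)
  have "min_det (m - i) = (2 - fps_X) * min_det (m - Suc i) - min_det (m - Suc i - 1)"
    using Suc.prems min_det_Suc[of "m - Suc i"] by (simp add: Suc_diff_Suc)
  with Suc show ?case by (simp add: algebra_simps)
qed

section \<open>The resolvent of the matrix of minima\<close>

text \<open>
  The candidate for \<open>D\<^sub>m(x) K (1 - x K)\<^sup>-\<^sup>1\<close>, assembled like every Green's function of a second-order
  equation: the solution for the left boundary condition times the one for the right boundary condition.
\<close>

definition green :: "nat \<Rightarrow> nat \<Rightarrow> nat \<Rightarrow> rat fps" where
  "green m i j = (if i \<le> j then cheb i * min_det (m - j) else cheb j * min_det (m - i))"

text \<open>
  Away from the diagonal this is the recurrence of the two factors. On the diagonal the kink of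
  \<open>green\<close> adds the Wronskian.
\<close>

lemma green_second_difference:
  assumes "i \<le> m" "1 \<le> j" "j \<le> m"
  shows "2 * green m i j - green m i (j - 1) - green m i (Suc j)
           = fps_X * green m i j + (if j = i then min_det m else 0)"
proof -
  obtain l where l: "j = Suc l" using assms by (cases j) auto
  have D: "min_det (m - l) = (2 - fps_X) * min_det (m - j) - min_det (m - Suc j)"
    using min_det_Suc[of "m - j"] assms l by (simp add: Suc_diff_Suc)
  consider "j < i" | "j = i" | "i < j" by linarith
  then show ?thesis
  proof cases
    case 1
    then have "green m i (Suc j) = cheb (Suc j) * min_det (m - i)"
      by (auto simp: green_def le_Suc_eq)
    with 1 l show ?thesis by (auto simp: green_def algebra_simps)
  next
    case 2
    show ?thesis
      using 2 l min_det_wronskian[of i m] assms by (auto simp: green_def algebra_simps)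
  next
    case 3
    with l show ?thesis by (auto simp: green_def algebra_simps D)
  qed
qed

text \<open>
  The matrix \<open>K\<close> inverts the negative second difference with boundary conditions \<open>f 0 = 0\<close> and
  \<open>f m = f (m + 1)\<close>; in general the second condition leaves an error term.
\<close>

lemma sum_min_second_difference:
  fixes f :: "nat \<Rightarrow> 'a :: comm_ring_1"
  assumes "f 0 = 0" "j \<le> m"
  shows "(\<Sum>k=1..m. of_nat (min k j) * (2 * f k - f (k - 1) - f (Suc k)))
           = f j + of_nat j * (f m - f (Suc m))"
  using assms(2)
proof (induction m rule: dec_induct)
  case base
  have "(\<Sum>k=1..j. of_nat k * (2 * f k - f (k - 1) - f (Suc k)))
           = f j + of_nat j * (f j - f (Suc j))"
    by (induction j) (simp_all add: assms(1) algebra_simps)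
  moreover have "(\<Sum>k=1..j. of_nat (min k j) * (2 * f k - f (k - 1) - f (Suc k)))
      = (\<Sum>k=1..j. of_nat k * (2 * f k - f (k - 1) - f (Suc k)))"
    by (rule sum.cong) auto
  ultimately show ?case by simp
next
  case (step m)
  then show ?case by (simp add: min_def algebra_simps)
qed

text \<open>
  Applying \<open>K\<close> to \<open>green_second_difference\<close> gives the equation \<open>H = D\<^sub>m K + x H K\<close> that characterises
  \<open>D\<^sub>m K (1 - x K)\<^sup>-\<^sup>1\<close>. The boundary error vanishes because of the truncation \<open>m - Suc m = 0\<close>.
\<close>

lemma green_equation:
  assumes "1 \<le> i" "i \<le> m" "j \<le> m"
  shows "green m i j
           = min_det m * of_nat (min i j) + fps_X * (\<Sum>k=1..m. green m i k * of_nat (min k j))"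
proof -
  have "green m i j = green m i j + of_nat j * (green m i m - green m i (Suc m))"
    using assms by (simp add: green_def)
  also have "\<dots> = (\<Sum>k=1..m. of_nat (min k j) *
      (2 * green m i k - green m i (k - 1) - green m i (Suc k)))"
    by (rule sum_min_second_difference[symmetric]) (use assms in \<open>auto simp: green_def\<close>)
  also have "\<dots> = (\<Sum>k=1..m. fps_X * (green m i k * of_nat (min k j))
      + (if k = i then of_nat (min k j) * min_det m else 0))"
  proof (rule sum.cong)
    fix k assume "k \<in> {1..m}"
    then have "2 * green m i k - green m i (k - 1) - green m i (Suc k)
        = fps_X * green m i k + (if k = i then min_det m else 0)"
      using assms by (intro green_second_difference) auto
    then show "of_nat (min k j) * (2 * green m i k - green m i (k - 1) - green m i (Suc k))
        = fps_X * (green m i k * of_nat (min k j)) + (if k = i then of_nat (min k j) * min_det m else 0)"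
      by (simp only:) (simp add: algebra_simps)
  qed simp
  also have "\<dots> = min_det m * of_nat (min i j)
      + fps_X * (\<Sum>k=1..m. green m i k * of_nat (min k j))"
    using assms by (simp add: sum.distrib sum_distrib_left)
  finally show ?thesis .
qed

text \<open>
  The entry \<open>(i, j)\<close> of \<open>K\<^bsup>n+1\<^esup>\<close>. The shift by one makes its generating series the resolvent
  \<open>K (1 - x K)\<^sup>-\<^sup>1\<close> and avoids the crown without elements.
\<close>

primrec min_power :: "nat \<Rightarrow> nat \<Rightarrow> nat \<Rightarrow> nat \<Rightarrow> nat" where
  "min_power m 0 i j = min i j"
| "min_power m (Suc n) i j = (\<Sum>k=1..m. min_power m n i k * min k j)"

definition min_resolvent :: "nat \<Rightarrow> nat \<Rightarrow> nat \<Rightarrow> rat fps" where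
  "min_resolvent m i j = Abs_fps (\<lambda>n. of_nat (min_power m n i j))"

lemma min_resolvent_equation:
  "min_resolvent m i j
     = of_nat (min i j) + fps_X * (\<Sum>k=1..m. min_resolvent m i k * of_nat (min k j))"
proof (rule fps_ext)
  fix n
  show "fps_nth (min_resolvent m i j) n = fps_nth (of_nat (min i j)
      + fps_X * (\<Sum>k=1..m. min_resolvent m i k * of_nat (min k j))) n"
    by (cases n) (simp_all add: min_resolvent_def fps_sum_nth fps_of_nat[symmetric])
qed

text \<open>The factor \<open>x\<close> makes each coefficient depend only on earlier ones, so all of them vanish.\<close>

lemma resolvent_equation_unique:
  fixes e :: "nat \<Rightarrow> 'a :: comm_ring_1 fps"
  assumes e: "\<And>j. j \<in> S \<Longrightarrow> e j = fps_X * (\<Sum>k\<in>S. e k * fps_const (a k j))"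
    and "j \<in> S"
  shows "e j = 0"
proof -
  have "\<forall>j\<in>S. fps_nth (e j) n = 0" for n
  proof (induction n)
    case 0
    show ?case
    proof
      fix j assume "j \<in> S"
      from arg_cong[OF e[OF this], of "\<lambda>f. fps_nth f 0"] show "fps_nth (e j) 0 = 0" by simp
    qed
  next
    case (Suc n)
    show ?case
    proof
      fix j assume "j \<in> S"
      from arg_cong[OF e[OF this], of "\<lambda>f. fps_nth f (Suc n)"] Suc
      show "fps_nth (e j) (Suc n) = 0" by (simp add: fps_sum_nth)
    qed
  qed
  with \<open>j \<in> S\<close> show ?thesis by (simp add: fps_eq_iff)
qed

lemma min_det_resolvent:
  assumes "i \<in> {1..m}" "j \<in> {1..m}"
  shows "min_det m * min_resolvent m i j = green m i j"
proof -
  have "min_det m * min_resolvent m i j - green m i j = 0"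
  proof (rule resolvent_equation_unique[where S = "{1..m}" and a = "\<lambda>k j. of_nat (min k j)"])
    fix j assume j: "j \<in> {1..m}"
    show "min_det m * min_resolvent m i j - green m i j
        = fps_X * (\<Sum>k=1..m. (min_det m * min_resolvent m i k - green m i k)
            * fps_const (of_nat (min k j)))"
      using assms j
      by (subst min_resolvent_equation, subst green_equation)
        (simp_all add: fps_of_nat algebra_simps sum_distrib_left sum_subtractf)
  qed fact
  then show ?thesis by simp
qed

lemma min_det_trace_resolvent:
  "min_det m * (\<Sum>i=1..m. min_resolvent m i i) = - fps_deriv (min_det m)"
proof -
  have "min_det m * (\<Sum>i=1..m. min_resolvent m i i) = (\<Sum>i=1..m. cheb i * min_det (m - i))"
    by (simp add: sum_distrib_left min_det_resolvent green_def)
  also have "\<dots> = (\<Sum>i\<le>m. cheb i * min_det (m - i))"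
    by (rule sum.mono_neutral_left) (auto simp: not_le)
  finally show ?thesis by (simp add: min_det_deriv)
qed

text \<open>
  Compare the coefficients of \<open>x\<^sup>n\<close> in \<open>D\<^sub>m \<cdot> tr (K (1 - x K)\<^sup>-\<^sup>1) = - D\<^sub>m'\<close>, the logarithmic derivative of
  the determinant.
\<close>

lemma newton_identity:
  "(\<Sum>k\<le>n. (- 1) ^ k * of_nat ((m + k) choose (2 * k)) * of_nat (\<Sum>i=1..m. min_power m (n - k) i i))
     = (- of_nat (Suc n) * ((- 1) ^ Suc n * of_nat ((m + Suc n) choose (2 * Suc n))) :: rat)" (is "?L = ?R")
proof -
  have "?L = fps_nth (min_det m * (\<Sum>i=1..m. min_resolvent m i i)) n"
    by (simp add: fps_mult_nth min_det_nth fps_sum_nth min_resolvent_def atLeast0AtMost)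
  also have "\<dots> = ?R"
    unfolding min_det_trace_resolvent fps_neg_nth fps_deriv_nth min_det_nth by (simp only: Suc_eq_plus1 minus_mult_left)
  finally show ?thesis .
qed

section \<open>Counting order-preserving maps of the crown\<close>

text \<open>
  A crown cut open at the relation between its first and last element is a fence. These are the
  order-preserving maps of the fence whose last value is \<open>j\<close>, and whose first value has the bound
  \<open>i\<close>; the maps with \<open>i = j\<close> are those that also respect the relation that was cut.
\<close>

definition fences :: "nat \<Rightarrow> nat \<Rightarrow> nat \<Rightarrow> nat \<Rightarrow> (nat \<Rightarrow> nat) set" where
  "fences m n i j = {f \<in> {1..2 * n} \<rightarrow>\<^sub>E {1..m}.
     (\<forall>k\<in>{1..n}. f (2 * k - 1) \<le> f (2 * k)) \<and> (\<forall>k\<in>{1..<n}. f (2 * k + 1) \<le> f (2 * k)) \<and>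
     f 1 \<le> i \<and> f (2 * n) = j}"

lemma finite_fences: "finite (fences m n i j)"
  by (rule finite_subset[of _ "{1..2 * n} \<rightarrow>\<^sub>E {1..m}"]) (auto simp: fences_def intro!: finite_PiE)


lemma card_fences_Suc0: "j \<in> {1..m} \<Longrightarrow> card (fences m 1 i j) = min i j"
proof -
  assume j: "j \<in> {1..m}"
  have two: "{1..2} = {1, 2 :: nat}" by auto
  have "bij_betw (\<lambda>a. (\<lambda>_. undefined)(1 := a, 2 := j)) {1..min i j} (fences m 1 i j)"
    by (rule bij_betw_byWitness[where f' = "\<lambda>f. f 1"])
      (use j in \<open>auto simp: fences_def two PiE_def Pi_def extensional_def fun_eq_iff\<close>)
  from bij_betw_same_card[OF this] show ?thesis by simp
qed

text \<open>
  Adding a minimal and a maximal element at the end of a fence multiplies by \<open>K\<close>: with last value \<open>k\<close>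
  before and \<open>j\<close> afterwards, the new minimal element has \<open>min k j\<close> possible values.
\<close>

lemma card_fences_Suc:
  assumes "n \<ge> 1" "j \<in> {1..m}"
  shows "card (fences m (Suc n) i j) = (\<Sum>k=1..m. card (fences m n i k) * min k j)"
proof -
  let ?F = "\<Union>k\<in>{1..m}. fences m n i k"
  have "bij_betw (\<lambda>(f, a). f(2 * n + 1 := a, 2 * n + 2 := j))
      (SIGMA f:?F. {1..min (f (2 * n)) j}) (fences m (Suc n) i j)"
  proof (rule bij_betw_byWitness[where f' = "\<lambda>g. (restrict g {1..2 * n}, g (2 * n + 1))"])
    show "\<forall>p\<in>SIGMA f:?F. {1..min (f (2 * n)) j}.
        (\<lambda>g. (restrict g {1..2 * n}, g (2 * n + 1))) ((\<lambda>(f, a). f(2 * n + 1 := a, 2 * n + 2 := j)) p) = p"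
      by (auto simp: fences_def fun_eq_iff PiE_def extensional_def)
    show "\<forall>g\<in>fences m (Suc n) i j. (\<lambda>(f, a). f(2 * n + 1 := a, 2 * n + 2 := j))
        (restrict g {1..2 * n}, g (2 * n + 1)) = g"
      by (auto simp: fences_def fun_eq_iff PiE_def extensional_def)
    show "(\<lambda>(f, a). f(2 * n + 1 := a, 2 * n + 2 := j)) ` (SIGMA f:?F. {1..min (f (2 * n)) j})
        \<subseteq> fences m (Suc n) i j"
    proof (rule image_subsetI, clarify)
      fix f a k assume k: "k \<in> {1..m}" and f: "f \<in> fences m n i k" and a: "a \<in> {1..min (f (2 * n)) j}"
      define g where "g = f(2 * n + 1 := a, 2 * n + 2 := j)"
      have old: "g x = f x" if "x \<le> 2 * n" for x
        using that by (simp add: g_def)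
      have new: "g (2 * n + 1) = a" "g (2 * n + 2) = j" by (simp_all add: g_def)
      have f_odd: "f (2 * k - 1) \<le> f (2 * k)" if "k \<in> {1..n}" for k
        using f that unfolding fences_def by blast
      have f_even: "f (2 * k + 1) \<le> f (2 * k)" if "k \<in> {1..<n}" for k
        using f that unfolding fences_def by blast
      have "g (2 * k - 1) \<le> g (2 * k)" if "k \<in> {1..Suc n}" for k
        using that f_odd[of k] a new old[of "2 * k - 1"] old[of "2 * k"]
        by (cases "k = Suc n") auto
      moreover have "g (2 * k + 1) \<le> g (2 * k)" if "k \<in> {1..<Suc n}" for k
        using that f_even[of k] a new old[of "2 * k + 1"] old[of "2 * k"]
        by (cases "k = n") auto
      moreover have "g \<in> {1..2 * Suc n} \<rightarrow>\<^sub>E {1..m}"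
      proof (rule PiE_I)
        fix x assume x: "x \<in> {1..2 * Suc n}"
        show "g x \<in> {1..m}"
        proof (cases "x \<le> 2 * n")
          case True
          with f x show ?thesis unfolding old[OF True] fences_def by (auto simp: PiE_def Pi_def)
        next
          case False
          with x have "x = 2 * n + 1 \<or> x = 2 * n + 2" by auto
          with new a assms(2) show ?thesis by auto
        qed
      next
        fix x assume "x \<notin> {1..2 * Suc n}"
        with f show "g x = undefined" by (auto simp: g_def fences_def PiE_def extensional_def)
      qed
      moreover have "g 1 \<le> i" "g (2 * Suc n) = j"
        using f assms(1) new by (auto simp: old fences_def)
      ultimately show "f(2 * n + 1 := a, 2 * n + 2 := j) \<in> fences m (Suc n) i j"
        unfolding g_def[symmetric] fences_def by blast
    qed
    show "(\<lambda>g. (restrict g {1..2 * n}, g (2 * n + 1))) ` fences m (Suc n) i j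
        \<subseteq> (SIGMA f:?F. {1..min (f (2 * n)) j})"
    proof (rule image_subsetI)
      fix g assume g: "g \<in> fences m (Suc n) i j"
      have r: "g x \<in> {1..m}" if "x \<in> {1..2 * Suc n}" for x
        using g that unfolding fences_def PiE_def Pi_def by blast
      have odd: "g (2 * k - 1) \<le> g (2 * k)" if "k \<in> {1..Suc n}" for k
        using g that unfolding fences_def by blast
      have even: "g (2 * k + 1) \<le> g (2 * k)" if "k \<in> {1..<Suc n}" for k
        using g that unfolding fences_def by blast
      have "restrict g {1..2 * n} \<in> fences m n i (g (2 * n))"
        unfolding fences_def
      proof (intro CollectI conjI ballI)
        show "restrict g {1..2 * n} \<in> {1..2 * n} \<rightarrow>\<^sub>E {1..m}"
          by (rule restrict_PiE_iff[THEN iffD2]) (auto intro!: r[simplified])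
        show "restrict g {1..2 * n} (2 * k - 1) \<le> restrict g {1..2 * n} (2 * k)"
          if "k \<in> {1..n}" for k using that odd[of k] by auto
        show "restrict g {1..2 * n} (2 * k + 1) \<le> restrict g {1..2 * n} (2 * k)"
          if "k \<in> {1..<n}" for k using that even[of k] by auto
        show "restrict g {1..2 * n} 1 \<le> i" using g assms(1) by (auto simp: fences_def)
      qed (use assms(1) in auto)
      moreover have "g (2 * n) \<in> {1..m}" using assms by (intro r) auto
      moreover have "g (2 * n + 1) \<in> {1..min (g (2 * n)) j}"
        using even[of n] odd[of "Suc n"] r[of "2 * n + 1"] g assms by (auto simp: fences_def)
      ultimately show "(restrict g {1..2 * n}, g (2 * n + 1)) \<in> (SIGMA f:?F. {1..min (f (2 * n)) j})"
        using assms(1) by auto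
    qed
  qed
  then have "card (fences m (Suc n) i j) = card (SIGMA f:?F. {1..min (f (2 * n)) j})"
    by (metis bij_betw_same_card)
  also have "\<dots> = (\<Sum>f\<in>?F. min (f (2 * n)) j)"
    by (subst card_SigmaI) (auto simp: finite_fences)
  also have "\<dots> = (\<Sum>k=1..m. \<Sum>f\<in>fences m n i k. min (f (2 * n)) j)"
    by (rule sum.UNION_disjoint) (auto simp: finite_fences, auto simp: fences_def)
  also have "\<dots> = (\<Sum>k=1..m. \<Sum>f\<in>fences m n i k. min k j)"
    by (intro sum.cong) (auto simp: fences_def)
  finally show ?thesis by simp
qed

lemma card_fences: "j \<in> {1..m} \<Longrightarrow> card (fences m (Suc n) i j) = min_power m n i j"
proof (induction n arbitrary: j)
  case 0
  then show ?case using card_fences_Suc0 by simp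
next
  case (Suc n)
  then show ?case by (simp add: card_fences_Suc)
qed

lemma monotone_on_crown_order:
  assumes "n \<ge> 1"
  shows "monotone_on {1..2 * n} (\<lambda>x y. (x, y) \<in> crown_order n) (\<le>) f \<longleftrightarrow>
    (\<forall>k\<in>{1..n}. f (2 * k - 1) \<le> f (2 * k)) \<and> (\<forall>k\<in>{1..<n}. f (2 * k + 1) \<le> f (2 * k)) \<and>
    f 1 \<le> (f (2 * n) :: 'a :: preorder)" (is "_ \<longleftrightarrow> ?R")
proof -
  have "monotone_on {1..2 * n} (\<lambda>x y. (x, y) \<in> crown_order n) (\<le>) f
      \<longleftrightarrow> (\<forall>(x, y)\<in>crown_covers n. f x \<le> f y)"
    using crown_covers_subset[OF assms]
    unfolding monotone_on_def crown_order_def trancl_crown_covers by fastforce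
  also have "\<dots> \<longleftrightarrow> ?R"
    unfolding crown_covers_def by (auto simp: Ball_def)
  finally show ?thesis .
qed

lemma card_crown_maps:
  "card (order_preserving_maps {1..2 * Suc n} (crown_order (Suc n)) m) = (\<Sum>i=1..m. min_power m n i i)"
proof -
  have "order_preserving_maps {1..2 * Suc n} (crown_order (Suc n)) m
      = (\<Union>i\<in>{1..m}. fences m (Suc n) i i)"
    unfolding order_preserving_maps_def
    by (subst monotone_on_crown_order) (auto simp: fences_def PiE_def Pi_def)
  also have "card \<dots> = (\<Sum>i=1..m. card (fences m (Suc n) i i))"
    by (rule card_UN_disjoint) (auto simp: finite_fences, auto simp: fences_def)
  finally show ?thesis by (simp add: card_fences)
qed

section \<open>Newton's identities for the order polynomials\<close>

definition crown_poly :: "nat \<Rightarrow> rat poly" where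
  "crown_poly n = order_polynomial {1..2 * n} (crown_order n)"

text \<open>
  The polynomial \<open>(-1)\<^sup>k (t + k choose 2 k)\<close>, split into linear factors.
\<close>

definition det_coeff_poly :: "nat \<Rightarrow> rat poly" where
  "det_coeff_poly k = smult ((- 1) ^ k / fact (2 * k)) (\<Prod>i<2 * k. [:of_nat k - of_nat i, 1:])"

lemma poly_det_coeff_poly:
  "poly (det_coeff_poly k) (of_nat m) = (- 1) ^ k * of_nat ((m + k) choose (2 * k))"
proof -
  have "of_nat ((m + k) choose (2 * k))
      = (\<Prod>i = 0..<2 * k. of_nat (m + k) - of_nat i :: rat) / fact (2 * k)"
    by (simp only: binomial_gbinomial gbinomial_prod_rev)
  then show ?thesis
    by (simp add: det_coeff_poly_def poly_prod lessThan_atLeast0 algebra_simps)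
qed

lemma det_coeff_poly_0: "det_coeff_poly 0 = 1"
  by (simp add: det_coeff_poly_def)

lemma poly_eqI_of_nat:
  fixes p q :: "'a :: {idom, ring_char_0} poly"
  assumes "\<And>m. m > 0 \<Longrightarrow> poly p (of_nat m) = poly q (of_nat m)"
  shows "p = q"
proof (rule ccontr)
  assume "p \<noteq> q"
  then have "finite {x. poly (p - q) x = 0}" by (intro poly_roots_finite) simp
  moreover have "of_nat ` {0<..} \<subseteq> {x. poly (p - q) x = 0}"
    using assms by auto
  ultimately have "finite (of_nat ` {0<..} :: 'a set)" by (rule finite_subset[rotated])
  then show False
    by (subst (asm) finite_image_iff) (auto simp: inj_on_def infinite_Ioi)
qed

lemma crown_poly_newton:
  "(\<Sum>k\<le>n. det_coeff_poly k * crown_poly (Suc (n - k)))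
     = smult (- of_nat (Suc n)) (det_coeff_poly (Suc n))"
proof (rule poly_eqI_of_nat)
  fix m :: nat assume "m > 0"
  then have "poly (crown_poly (Suc k)) (of_nat m) = of_nat (\<Sum>i=1..m. min_power m k i i)" for k
    unfolding crown_poly_def
    by (subst poly_order_polynomial) (simp_all only: card_crown_maps finite_atLeastAtMost)
  then show "poly (\<Sum>k\<le>n. det_coeff_poly k * crown_poly (Suc (n - k))) (of_nat m)
      = poly (smult (- of_nat (Suc n)) (det_coeff_poly (Suc n))) (of_nat m)"
    unfolding poly_sum poly_mult poly_smult poly_det_coeff_poly by (simp only: newton_identity)
qed

section \<open>The linear coefficient\<close>

text \<open>
  These are the values at \<open>0\<close> of the factors of \<open>det_coeff_poly (Suc n)\<close>. They run through the integers from \<open>n + 1\<close> down to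
  \<open>-n\<close>, with \<open>0\<close> left out.
\<close>

lemma prod_int_window:
  "(\<Prod>i\<in>{..<2 * Suc n} - {Suc n}. of_nat (Suc n) - of_nat i :: rat) = fact (Suc n) * (- 1) ^ n * fact n"
proof -
  have "{..<2 * Suc n} - {Suc n} = {..<Suc n} \<union> {Suc n<..<2 * Suc n}" by auto
  then have "(\<Prod>i\<in>{..<2 * Suc n} - {Suc n}. of_nat (Suc n) - of_nat i :: rat)
      = (\<Prod>i\<in>{..<Suc n} \<union> {Suc n<..<2 * Suc n}. of_nat (Suc n) - of_nat i)"
    by (rule arg_cong)
  also have "\<dots> = (\<Prod>i<Suc n. of_nat (Suc n) - of_nat i) * (\<Prod>i\<in>{Suc n<..<2 * Suc n}. of_nat (Suc n) - of_nat i)"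
    by (rule prod.union_disjoint) auto
  also have "(\<Prod>i<Suc n. of_nat (Suc n) - of_nat i :: rat) = (\<Prod>i=1..Suc n. of_nat i)"
    by (rule prod.reindex_bij_witness[of _ "\<lambda>i. Suc n - i" "\<lambda>i. Suc n - i"])
      (simp_all add: less_Suc_eq_le, auto)
  also have "(\<Prod>i\<in>{Suc n<..<2 * Suc n}. of_nat (Suc n) - of_nat i :: rat) = (\<Prod>i=1..n. - of_nat i)"
    by (rule prod.reindex_bij_witness[of _ "\<lambda>i. Suc n + i" "\<lambda>i. i - Suc n"])
      (auto simp: of_nat_diff)
  also have "\<dots> = (- 1) ^ n * fact n"
    by (simp add: prod_uminus fact_prod)
  also have "(\<Prod>i=1..Suc n. of_nat i) * ((- 1) ^ n * fact n) = fact (Suc n) * (- 1) ^ n * (fact n :: rat)"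
    by (simp only: fact_prod of_nat_prod mult.assoc)
  finally show ?thesis .
qed

text \<open>
  The factor with index \<open>Suc n\<close> is the variable itself, so the linear coefficient is the leading
  constant times the product of the remaining factors at \<open>0\<close>.
\<close>

lemma det_coeff_poly_low:
  "coeff (det_coeff_poly (Suc n)) 0 = 0"
  "coeff (det_coeff_poly (Suc n)) 1 = - (fact (Suc n) * fact n / fact (2 * Suc n))"
proof -
  let ?Q = "\<Prod>i\<in>{..<2 * Suc n} - {Suc n}. [:of_nat (Suc n) - of_nat i, 1 :: rat:]"
  have "(\<Prod>i<2 * Suc n. [:of_nat (Suc n) - of_nat i, 1 :: rat:]) = pCons 0 ?Q"
    by (subst prod.remove[where x = "Suc n"]) auto
  then have eq: "det_coeff_poly (Suc n) = smult ((- 1) ^ Suc n / fact (2 * Suc n)) (pCons 0 ?Q)"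
    by (simp only: det_coeff_poly_def)
  have "coeff ?Q 0 = (\<Prod>i\<in>{..<2 * Suc n} - {Suc n}. of_nat (Suc n) - of_nat i)"
    by (simp only: poly_0_coeff_0[symmetric] poly_prod) simp
  then have Q: "coeff ?Q 0 = fact (Suc n) * (- 1) ^ n * fact n"
    by (simp only: prod_int_window)
  show "coeff (det_coeff_poly (Suc n)) 0 = 0" by (simp add: eq)
  have "coeff (det_coeff_poly (Suc n)) 1 = (- 1) ^ Suc n / fact (2 * Suc n) * coeff ?Q 0"
    unfolding eq by (simp only: coeff_smult One_nat_def coeff_pCons_Suc)
  also have "\<dots> = - (fact (Suc n) * fact n / fact (2 * Suc n)) * ((- 1) ^ n * (- 1) ^ n)"
    unfolding Q by simp
  also have "(- 1 :: rat) ^ n * (- 1) ^ n = 1" by (simp flip: power_mult_distrib)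
  finally show "coeff (det_coeff_poly (Suc n)) 1 = - (fact (Suc n) * fact n / fact (2 * Suc n))"
    by simp
qed

lemma crown_poly_newton_split:
  "crown_poly (Suc n) = smult (- of_nat (Suc n)) (det_coeff_poly (Suc n))
     - (\<Sum>k<n. det_coeff_poly (Suc k) * crown_poly (n - k))"
proof -
  have "(\<Sum>k\<le>n. det_coeff_poly k * crown_poly (Suc (n - k)))
      = crown_poly (Suc n) + (\<Sum>k<n. det_coeff_poly (Suc k) * crown_poly (Suc (n - Suc k)))"
    by (simp only: lessThan_Suc_atMost[symmetric] sum.lessThan_Suc_shift det_coeff_poly_0) simp
  also have "(\<Sum>k<n. det_coeff_poly (Suc k) * crown_poly (Suc (n - Suc k)))
      = (\<Sum>k<n. det_coeff_poly (Suc k) * crown_poly (n - k))"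
    by (intro sum.cong) (simp_all only: Suc_diff_Suc lessThan_iff)
  finally show ?thesis unfolding crown_poly_newton by simp
qed

lemma coeff_mult_1: "coeff (p * q) 1 = coeff p 0 * coeff q 1 + coeff p 1 * coeff q 0"
  by (simp add: coeff_mult)

lemma coeff_crown_poly_0: "coeff (crown_poly (Suc n)) 0 = 0"
  by (subst crown_poly_newton_split) (simp add: coeff_sum coeff_mult_0 det_coeff_poly_low)

theorem corollary4p5:
  fixes n :: nat
  assumes "n \<ge> 1"
  shows "coeff (order_polynomial {1..2 * n} (crown_order n)) 1 = inverse (of_nat ((2 * n) choose n))"
proof -
  obtain l where n: "n = Suc l" using assms by (cases n) auto
  \<comment> \<open>Both factors vanish at \<open>0\<close>, so their product has no linear term.\<close>
  have z: "coeff (det_coeff_poly (Suc k) * crown_poly (l - k)) 1 = 0" if "k < l" for k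
  proof -
    have "coeff (crown_poly (l - k)) 0 = 0"
      using coeff_crown_poly_0[of "l - Suc k"] that by (simp only: Suc_diff_Suc)
    then show ?thesis by (simp only: coeff_mult_1 det_coeff_poly_low mult_zero_left mult_zero_right add_0)
  qed
  have "coeff (crown_poly n) 1 = - of_nat n * coeff (det_coeff_poly n) 1
      - (\<Sum>k<l. coeff (det_coeff_poly (Suc k) * crown_poly (l - k)) 1)"
    unfolding n by (subst crown_poly_newton_split) (simp only: coeff_diff coeff_sum coeff_smult)
  also have "(\<Sum>k<l. coeff (det_coeff_poly (Suc k) * crown_poly (l - k)) 1) = 0"
    by (intro sum.neutral ballI z) (simp only: lessThan_iff)
  also have "- of_nat n * coeff (det_coeff_poly n) 1 - 0 = fact n * fact n / fact (2 * n)"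
    unfolding n det_coeff_poly_low
    by (simp only: fact_Suc[of l] diff_0_right minus_mult_minus times_divide_eq_right mult_ac)
  also have "\<dots> = inverse (of_nat ((2 * n) choose n))"
    by (simp add: binomial_fact)
  finally show ?thesis by (simp only: crown_poly_def)
qed

end
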